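(* Let $X$ be an integrable random variable whose distribution has infinite essential infimum and infinite essential supremum (i.e. $\operatorname{ess\,inf}X=-\infty$ and $\operatorname{ess\,sup}X=+\infty$). Then the (non-centred) zonoid $Z_\xi$ of a random variable $\xi=\mu+\sigma X$ from the location-scale family generated by $X$ uniquely determines the location parameter $\mu\in\mathbb{R}$ and the scale parameter $\sigma>0$: if $\mu,\mu^*\in\mathbb{R}$, $\sigma,\sigma^*>0$ and $Z_{\mu+\sigma X}=Z_{\mu^*+\sigma^*X}$, then $\mu=\mu^*$ and $\sigma=\sigma^*$.
   Context: The zonoid $Z_\xi$ of an integrable random vector $\xi$ in $\mathbb{R}^d$ is the convex body with support function $h_{Z_\xi}(u)=\mathbf{E}\langle u,\xi\rangle_+$, $u\in\mathbb{R}^d$, where $x_+=\max(x,0)$. For $d=1$, $Z_\xi$ is the segment $[-\mathbf{E}\xi_-,\mathbf{E}\xi_+]$ with $\xi_-=\max(-\xi,0)$; thus $Z_\xi=Z_{\xi^*}$ means $\mathbf{E}\xi_+=\mathbf{E}\xi^*_+$ and $\mathbf{E}\xi_-=\mathbf{E}\xi^*_-$. The location-scale family generated by $X$ consists of the random variables $\mu+\sigma X$ with $\mu\in\mathbb{R}$, $\sigma>0$. *)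

theory Defs
  imports "HOL-Probability.Probability"
begin

definition essinf :: "'a measure \<Rightarrow> ('a \<Rightarrow> ereal) \<Rightarrow> ereal" where
  "essinf M f = Sup {z. AE x in M. z \<le> f x}"

text \<open>As usual in this setting, convex bodies may be lower-dimensional: no interior point is required.\<close>

definition convex_body :: "'a::euclidean_space set \<Rightarrow> bool" where
  "convex_body K \<longleftrightarrow> K \<noteq> {} \<and> compact K \<and> convex K"

definition support_function :: "'a::euclidean_space set \<Rightarrow> 'a \<Rightarrow> real" where
  "support_function K u = (SUP x\<in>K. u \<bullet> x)"

text \<open>Meaningful for integrable \<open>\<xi>\<close>: existence and uniqueness of the convex body are shown below.\<close>

definition zonoid :: "'b measure \<Rightarrow> ('b \<Rightarrow> 'a::euclidean_space) \<Rightarrow> 'a set" where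
  "zonoid M \<xi> = (THE K. convex_body K \<and>
     (\<forall>u. support_function K u = (\<integral>\<omega>. max (u \<bullet> \<xi> \<omega>) 0 \<partial>M)))"

lemma support_function_upper:
  assumes "convex_body K" "x \<in> K"
  shows "u \<bullet> x \<le> support_function K u"
proof -
  have "compact ((\<lambda>x. u \<bullet> x) ` K)"
    using assms by (intro compact_continuous_image continuous_intros) (auto simp: convex_body_def)
  then have "bdd_above ((\<lambda>x. u \<bullet> x) ` K)"
    by (simp add: compact_imp_bounded bounded_imp_bdd_above)
  then show ?thesis
    using assms(2) unfolding support_function_def by (rule cSUP_upper2) simp
qed

lemma support_function_subset:
  assumes K: "convex_body K" and L: "convex_body L"
    and le: "\<And>u. support_function K u \<le> support_function L u"
  shows "K \<subseteq> L"
proof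
  fix x assume x: "x \<in> K"
  show "x \<in> L"
  proof (rule ccontr)
    assume "x \<notin> L"
    then obtain a b where a: "a \<bullet> x < b" "\<And>y. y \<in> L \<Longrightarrow> b < a \<bullet> y"
      using separating_hyperplane_closed_point[of L x] L
      by (auto simp: convex_body_def compact_imp_closed)
    have "support_function L (- a) \<le> - b"
      unfolding support_function_def using L a(2)
      by (intro cSUP_least) (auto simp: convex_body_def less_imp_le)
    moreover have "- a \<bullet> x \<le> support_function K (- a)"
      by (rule support_function_upper[OF K x])
    ultimately show False using le[of "- a"] a(1) by simp
  qed
qed

lemma support_function_inject:
  assumes "convex_body K" "convex_body L" "\<And>u. support_function K u = support_function L u"
  shows "K = L"
  using support_function_subset[of K L] support_function_subset[of L K] assms by auto

lemma zonoid_exists: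
  fixes \<xi> :: "'b \<Rightarrow> 'a::euclidean_space"
  assumes int: "integrable M \<xi>"
  shows "\<exists>K. convex_body K \<and> (\<forall>u. support_function K u = (\<integral>\<omega>. max (u \<bullet> \<xi> \<omega>) 0 \<partial>M))"
proof -
  define P where "P = {\<phi> \<in> borel_measurable M. \<forall>\<omega>. 0 \<le> \<phi> \<omega> \<and> \<phi> \<omega> \<le> (1::real)}"
  define S where "S = (\<lambda>\<phi>. \<integral>\<omega>. \<phi> \<omega> *\<^sub>R \<xi> \<omega> \<partial>M) ` P"
  have meas: "\<xi> \<in> borel_measurable M" using int by auto
  have intP: "integrable M (\<lambda>\<omega>. \<phi> \<omega> *\<^sub>R \<xi> \<omega>)" if "\<phi> \<in> P" for \<phi>
    by (rule Bochner_Integration.integrable_bound[OF int])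
       (use that meas in \<open>auto simp: P_def intro!: mult_left_le_one_le\<close>)
  have intm: "integrable M (\<lambda>\<omega>. max (u \<bullet> \<xi> \<omega>) 0)" for u
    using int by (intro integrable_max) auto
  have up: "u \<bullet> x \<le> (\<integral>\<omega>. max (u \<bullet> \<xi> \<omega>) 0 \<partial>M)" if "x \<in> closure S" for u x
  proof -
    have "S \<subseteq> {x. u \<bullet> x \<le> (\<integral>\<omega>. max (u \<bullet> \<xi> \<omega>) 0 \<partial>M)}"
    proof safe
      fix x assume "x \<in> S"
      then obtain \<phi> where p: "\<phi> \<in> P" and x: "x = (\<integral>\<omega>. \<phi> \<omega> *\<^sub>R \<xi> \<omega> \<partial>M)"
        by (auto simp: S_def)
      have "u \<bullet> x = (\<integral>\<omega>. u \<bullet> (\<phi> \<omega> *\<^sub>R \<xi> \<omega>) \<partial>M)"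
        unfolding x by (rule integral_inner_right[symmetric]) (use intP[OF p] in auto)
      also have "\<dots> \<le> (\<integral>\<omega>. max (u \<bullet> \<xi> \<omega>) 0 \<partial>M)"
      proof (rule integral_mono)
        show "integrable M (\<lambda>\<omega>. u \<bullet> (\<phi> \<omega> *\<^sub>R \<xi> \<omega>))"
          by (rule integrable_inner_right) (use intP[OF p] in simp)
        show "integrable M (\<lambda>\<omega>. max (u \<bullet> \<xi> \<omega>) 0)" by (rule intm)
        fix \<omega>
        have "\<phi> \<omega> * (u \<bullet> \<xi> \<omega>) \<le> \<phi> \<omega> * max (u \<bullet> \<xi> \<omega>) 0"
          using p by (intro mult_left_mono) (auto simp: P_def)
        also have "\<dots> \<le> max (u \<bullet> \<xi> \<omega>) 0"
          using p by (intro mult_left_le_one_le) (auto simp: P_def)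
        finally show "u \<bullet> (\<phi> \<omega> *\<^sub>R \<xi> \<omega>) \<le> max (u \<bullet> \<xi> \<omega>) 0" by simp
      qed
      finally show "u \<bullet> x \<le> (\<integral>\<omega>. max (u \<bullet> \<xi> \<omega>) 0 \<partial>M)" .
    qed
    then have "closure S \<subseteq> {x. u \<bullet> x \<le> (\<integral>\<omega>. max (u \<bullet> \<xi> \<omega>) 0 \<partial>M)}"
      by (rule closure_minimal) (rule closed_halfspace_le)
    then show ?thesis using that by auto
  qed
  have att: "\<exists>x\<in>S. u \<bullet> x = (\<integral>\<omega>. max (u \<bullet> \<xi> \<omega>) 0 \<partial>M)" for u
  proof -
    define \<phi> where "\<phi> \<omega> = (if 0 < u \<bullet> \<xi> \<omega> then 1 else 0::real)" for \<omega>
    have p: "\<phi> \<in> P" unfolding P_def \<phi>_def using meas by auto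
    have "u \<bullet> (\<integral>\<omega>. \<phi> \<omega> *\<^sub>R \<xi> \<omega> \<partial>M) = (\<integral>\<omega>. u \<bullet> (\<phi> \<omega> *\<^sub>R \<xi> \<omega>) \<partial>M)"
      by (rule integral_inner_right[symmetric]) (use intP[OF p] in auto)
    also have "\<dots> = (\<integral>\<omega>. max (u \<bullet> \<xi> \<omega>) 0 \<partial>M)"
      by (rule Bochner_Integration.integral_cong) (auto simp: \<phi>_def)
    finally show ?thesis using p by (auto simp: S_def)
  qed
  have "bounded S"
  proof (rule boundedI)
    fix x assume "x \<in> S"
    then obtain \<phi> where p: "\<phi> \<in> P" and x: "x = (\<integral>\<omega>. \<phi> \<omega> *\<^sub>R \<xi> \<omega> \<partial>M)"
      by (auto simp: S_def)
    have "norm x \<le> (\<integral>\<omega>. norm (\<phi> \<omega> *\<^sub>R \<xi> \<omega>) \<partial>M)"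
      unfolding x by (rule Bochner_Integration.integral_norm_bound)
    also have "\<dots> \<le> (\<integral>\<omega>. norm (\<xi> \<omega>) \<partial>M)"
    proof (rule integral_mono)
      show "integrable M (\<lambda>\<omega>. norm (\<phi> \<omega> *\<^sub>R \<xi> \<omega>))"
        by (rule integrable_norm[OF intP[OF p]])
      show "integrable M (\<lambda>\<omega>. norm (\<xi> \<omega>))"
        by (rule integrable_norm[OF int])
    qed (use p in \<open>auto simp: P_def intro!: mult_left_le_one_le\<close>)
    finally show "norm x \<le> (\<integral>\<omega>. norm (\<xi> \<omega>) \<partial>M)" .
  qed
  moreover have "convex S"
  proof (rule convexI)
    fix x y and s t :: real
    assume "x \<in> S" "y \<in> S" and st: "0 \<le> s" "0 \<le> t" "s + t = 1"
    then obtain \<phi> \<psi> where p: "\<phi> \<in> P" "\<psi> \<in> P"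
      and x: "x = (\<integral>\<omega>. \<phi> \<omega> *\<^sub>R \<xi> \<omega> \<partial>M)" and y: "y = (\<integral>\<omega>. \<psi> \<omega> *\<^sub>R \<xi> \<omega> \<partial>M)"
      by (auto simp: S_def)
    have "(\<lambda>\<omega>. s * \<phi> \<omega> + t * \<psi> \<omega>) \<in> P"
      using p st by (auto simp: P_def intro!: convex_bound_le)
    moreover have "(\<integral>\<omega>. (s * \<phi> \<omega> + t * \<psi> \<omega>) *\<^sub>R \<xi> \<omega> \<partial>M) =
        (\<integral>\<omega>. s *\<^sub>R (\<phi> \<omega> *\<^sub>R \<xi> \<omega>) + t *\<^sub>R (\<psi> \<omega> *\<^sub>R \<xi> \<omega>) \<partial>M)"
      by (simp add: scaleR_add_left)
    moreover have "\<dots> = s *\<^sub>R x + t *\<^sub>R y"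
      unfolding x y
      by (subst Bochner_Integration.integral_add)
         (use intP[OF p(1)] intP[OF p(2)] in \<open>auto simp del: scaleR_scaleR\<close>)
    ultimately show "s *\<^sub>R x + t *\<^sub>R y \<in> S"
      unfolding S_def by (intro image_eqI[where x = "\<lambda>\<omega>. s * \<phi> \<omega> + t * \<psi> \<omega>"]) simp_all
  qed
  moreover have "S \<noteq> {}" using att by auto
  ultimately have cb: "convex_body (closure S)"
    by (auto simp: convex_body_def compact_closure convex_closure)
  have "support_function (closure S) u = (\<integral>\<omega>. max (u \<bullet> \<xi> \<omega>) 0 \<partial>M)" for u
  proof (rule antisym)
    show "support_function (closure S) u \<le> (\<integral>\<omega>. max (u \<bullet> \<xi> \<omega>) 0 \<partial>M)"
      unfolding support_function_def using up cb
      by (intro cSUP_least) (auto simp: convex_body_def)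
    obtain x where "x \<in> S" "u \<bullet> x = (\<integral>\<omega>. max (u \<bullet> \<xi> \<omega>) 0 \<partial>M)" using att by blast
    then show "(\<integral>\<omega>. max (u \<bullet> \<xi> \<omega>) 0 \<partial>M) \<le> support_function (closure S) u"
      using support_function_upper[OF cb] closure_subset by (metis subsetD)
  qed
  then show ?thesis using cb by blast
qed

lemma zonoid_unique:
  fixes \<xi> :: "'b \<Rightarrow> 'a::euclidean_space"
  assumes "integrable M \<xi>"
  shows "\<exists>!K. convex_body K \<and> (\<forall>u. support_function K u = (\<integral>\<omega>. max (u \<bullet> \<xi> \<omega>) 0 \<partial>M))"
proof (rule ex_ex1I[OF zonoid_exists[OF assms]])
qed (metis support_function_inject)

lemma
  fixes \<xi> :: "'b \<Rightarrow> 'a::euclidean_space"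
  assumes "integrable M \<xi>"
  shows convex_body_zonoid: "convex_body (zonoid M \<xi>)"
    and support_function_zonoid:
      "support_function (zonoid M \<xi>) u = (\<integral>\<omega>. max (u \<bullet> \<xi> \<omega>) 0 \<partial>M)"
  using theI'[OF zonoid_unique[OF assms]] unfolding zonoid_def by auto

end

(* Write mu + sigma X = sigma (a + X) with a = mu / sigma. If a <= a' and sigma < sigma', then
   sigma (a + X)_+ <= sigma' (a' + X)_+ pointwise, strictly where X > - a, so the right end points
   of the segments differ because X is unbounded above. The case a >= a' is the same statement for
   - X and the left end points. Once sigma = sigma', the expectations E xi = E xi_+ - E xi_-
   determine mu. *)
theory Submission
  imports Defs
begin

text \<open>Integrability makes the definite description in \<open>zonoid\<close> denote, so the
  expectation can be read off the set as its support function at \<open>u\<close>.\<close>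

lemma zonoid_eq_positive_part:
  fixes \<xi> \<eta> :: "'b \<Rightarrow> 'a::euclidean_space"
  assumes "integrable M \<xi>" "integrable M \<eta>" "zonoid M \<xi> = zonoid M \<eta>"
  shows "(\<integral>\<omega>. max (u \<bullet> \<xi> \<omega>) 0 \<partial>M) = (\<integral>\<omega>. max (u \<bullet> \<eta> \<omega>) 0 \<partial>M)"
  using assms by (metis support_function_zonoid)

text \<open>Measurability matters here: on a non-measurable function \<open>esssup\<close> takes the
  default value \<open>top\<close>, which says nothing about almost sure bounds.\<close>

lemma not_AE_le_of_esssup_infinity:
  fixes X :: "'a \<Rightarrow> real"
  assumes "X \<in> borel_measurable M" "esssup M (\<lambda>\<omega>. ereal (X \<omega>)) = \<infinity>"
  shows "\<not> (AE \<omega> in M. X \<omega> \<le> c)"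
proof
  assume "AE \<omega> in M. X \<omega> \<le> c"
  then have "esssup M (\<lambda>\<omega>. ereal (X \<omega>)) \<le> ereal c"
    using assms(1) by (intro esssup_I) auto
  then show False using assms(2) by simp
qed

lemma not_AE_ge_of_essinf_minus_infinity:
  fixes X :: "'a \<Rightarrow> real"
  assumes "essinf M (\<lambda>\<omega>. ereal (X \<omega>)) = -\<infinity>"
  shows "\<not> (AE \<omega> in M. c \<le> X \<omega>)"
proof
  assume "AE \<omega> in M. c \<le> X \<omega>"
  then have "ereal c \<le> essinf M (\<lambda>\<omega>. ereal (X \<omega>))"
    unfolding essinf_def by (intro Sup_upper) simp
  then show False using assms by simp
qed

text \<open>The condition on the ratios orders the zeros of the two affine maps: the steeper one
  vanishes no later, so it dominates wherever the other is positive. Only unboundedness above is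
  assumed, so that the lemma can also be applied to \<open>- X\<close>.\<close>

lemma positive_part_location_scale_less:
  fixes X :: "'a \<Rightarrow> real"
  assumes "finite_measure M" and X: "integrable M X"
    and unbdd: "\<And>c. \<not> (AE \<omega> in M. X \<omega> \<le> c)"
    and s: "0 < \<sigma>" "\<sigma> < \<sigma>'" and le: "\<mu> / \<sigma> \<le> \<mu>' / \<sigma>'"
  shows "(\<integral>\<omega>. max (\<mu> + \<sigma> * X \<omega>) 0 \<partial>M) < (\<integral>\<omega>. max (\<mu>' + \<sigma>' * X \<omega>) 0 \<partial>M)"
proof -
  interpret finite_measure M by fact
  let ?f = "\<lambda>\<omega>. max (\<mu> + \<sigma> * X \<omega>) 0" and ?g = "\<lambda>\<omega>. max (\<mu>' + \<sigma>' * X \<omega>) 0"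
  have f: "integrable M ?f" and g: "integrable M ?g"
    using X by (auto intro!: integrable_max)
  have factor: "\<mu> + \<sigma> * x = \<sigma> * (\<mu> / \<sigma> + x)" "\<mu>' + \<sigma>' * x = \<sigma>' * (\<mu>' / \<sigma>' + x)" for x
    using s by (auto simp: algebra_simps)
  have less: "\<mu> + \<sigma> * x < \<mu>' + \<sigma>' * x" if "- (\<mu> / \<sigma>) < x" for x
    unfolding factor using s le that by (intro mult_less_le_imp_less) auto
  have fg: "?f \<omega> \<le> ?g \<omega>" for \<omega>
  proof (cases "- (\<mu> / \<sigma>) < X \<omega>")
    case True
    then show ?thesis using less[of "X \<omega>"] by simp
  next
    case False
    then have "\<mu> + \<sigma> * X \<omega> \<le> 0"
      unfolding factor using s by (intro mult_nonneg_nonpos) auto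
    then show ?thesis by simp
  qed
  \<comment> \<open>Given \<open>?f \<le> ?g\<close>, equal integrals would force equality almost
    everywhere. Equality fails wherever \<open>X\<close> exceeds
    \<open>- (\<mu> / \<sigma>)\<close>, so this number would be an almost sure upper bound of
    \<open>X\<close>.\<close>
  have "integral\<^sup>L M ?f \<noteq> integral\<^sup>L M ?g"
  proof
    assume "integral\<^sup>L M ?f = integral\<^sup>L M ?g"
    then have "AE \<omega> in M. ?f \<omega> = ?g \<omega>"
      using f g fg by (intro integral_eq_mono_AE_eq_AE) auto
    moreover have "X \<omega> \<le> - (\<mu> / \<sigma>)" if "?f \<omega> = ?g \<omega>" for \<omega>
    proof (rule ccontr)
      assume "\<not> X \<omega> \<le> - (\<mu> / \<sigma>)"
      then have x: "- (\<mu> / \<sigma>) < X \<omega>" by simp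
      have "0 < \<mu> + \<sigma> * X \<omega>"
        unfolding factor using s x by (intro mult_pos_pos) auto
      then show False using that less[OF x] by simp
    qed
    ultimately have "AE \<omega> in M. X \<omega> \<le> - (\<mu> / \<sigma>)"
      by (auto elim: AE_mp)
    then show False using unbdd by blast
  qed
  moreover have "integral\<^sup>L M ?f \<le> integral\<^sup>L M ?g"
    using f g fg by (rule integral_mono)
  ultimately show ?thesis by simp
qed

text \<open>Each order of the ratios of location to scale is refuted by one end point of the
  segment. Exchanging the two parameter pairs then excludes the opposite strict inequality as
  well.\<close>

lemma not_scale_less:
  fixes X :: "'a \<Rightarrow> real"
  assumes M: "finite_measure M" and X: "integrable M X"
    and inf: "essinf M (\<lambda>\<omega>. ereal (X \<omega>)) = -\<infinity>"
    and sup: "esssup M (\<lambda>\<omega>. ereal (X \<omega>)) = \<infinity>"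
    and s: "0 < \<sigma>"
    and pos: "(\<integral>\<omega>. max (\<mu> + \<sigma> * X \<omega>) 0 \<partial>M) = (\<integral>\<omega>. max (\<mu>' + \<sigma>' * X \<omega>) 0 \<partial>M)"
    and neg: "(\<integral>\<omega>. max (- (\<mu> + \<sigma> * X \<omega>)) 0 \<partial>M) = (\<integral>\<omega>. max (- (\<mu>' + \<sigma>' * X \<omega>)) 0 \<partial>M)"
  shows "\<not> \<sigma> < \<sigma>'"
proof
  assume less: "\<sigma> < \<sigma>'"
  show False
  proof (cases "\<mu> / \<sigma> \<le> \<mu>' / \<sigma>'")
    case True
    have "\<not> (AE \<omega> in M. X \<omega> \<le> c)" for c
      using X sup by (intro not_AE_le_of_esssup_infinity) auto
    from positive_part_location_scale_less[OF M X this s less True] pos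
    show False by simp
  next
    case False
    \<comment> \<open>Since \<open>- (\<mu> + \<sigma> * X \<omega>) = - \<mu> + \<sigma> * - X
      \<omega>\<close>, reflection keeps the scales and reverses the order of the ratios, so the
      comparison applies to \<open>- X\<close>.\<close>
    have "\<not> (AE \<omega> in M. - X \<omega> \<le> c)" for c
      using not_AE_ge_of_essinf_minus_infinity[OF inf, of "- c"] by (simp add: minus_le_iff)
    moreover have "integrable M (\<lambda>\<omega>. - X \<omega>)" "- \<mu> / \<sigma> \<le> - \<mu>' / \<sigma>'"
      using X False by auto
    ultimately have "(\<integral>\<omega>. max (- \<mu> + \<sigma> * - X \<omega>) 0 \<partial>M) < (\<integral>\<omega>. max (- \<mu>' + \<sigma>' * - X \<omega>) 0 \<partial>M)"
      using M s less by (intro positive_part_location_scale_less)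
    then show False using neg by simp
  qed
qed

theorem theorem29:
  fixes M :: "'a measure" and X :: "'a \<Rightarrow> real" and \<mu> \<mu>' \<sigma> \<sigma>' :: real
  assumes "prob_space M"
    and "integrable M X"
    and "essinf M (\<lambda>\<omega>. ereal (X \<omega>)) = -\<infinity>"
    and "esssup M (\<lambda>\<omega>. ereal (X \<omega>)) = \<infinity>"
    and "\<sigma> > 0" and "\<sigma>' > 0"
    and "zonoid M (\<lambda>\<omega>. \<mu> + \<sigma> * X \<omega>) = zonoid M (\<lambda>\<omega>. \<mu>' + \<sigma>' * X \<omega>)"
  shows "\<mu> = \<mu>' \<and> \<sigma> = \<sigma>'"
proof -
  interpret prob_space M by fact
  note X = assms(2)
  have int: "integrable M (\<lambda>\<omega>. m + s * X \<omega>)" for m s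
    using X by simp
  note parts = zonoid_eq_positive_part[OF int int assms(7)]
  \<comment> \<open>The directions \<open>1\<close> and \<open>- 1\<close> give the right end point
    and the negated left end point of the segment.\<close>
  have pos: "(\<integral>\<omega>. max (\<mu> + \<sigma> * X \<omega>) 0 \<partial>M) = (\<integral>\<omega>. max (\<mu>' + \<sigma>' * X \<omega>) 0 \<partial>M)"
    using parts[of 1] by simp
  have neg: "(\<integral>\<omega>. max (- (\<mu> + \<sigma> * X \<omega>)) 0 \<partial>M) = (\<integral>\<omega>. max (- (\<mu>' + \<sigma>' * X \<omega>)) 0 \<partial>M)"
    using parts[of "- 1"] by simp
  have "\<sigma> = \<sigma>'"
    using not_scale_less[OF finite_measure_axioms X assms(3,4) assms(5) pos neg]
      not_scale_less[OF finite_measure_axioms X assms(3,4) assms(6) pos[symmetric] neg[symmetric]]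
    by simp
  have mean: "m + s * expectation X =
      (\<integral>\<omega>. max (m + s * X \<omega>) 0 \<partial>M) - (\<integral>\<omega>. max (- (m + s * X \<omega>)) 0 \<partial>M)" for m s
  proof -
    have "m + s * expectation X = (\<integral>\<omega>. m + s * X \<omega> \<partial>M)"
      using X by (simp add: prob_space)
    also have "\<dots> = (\<integral>\<omega>. max (m + s * X \<omega>) 0 - max (- (m + s * X \<omega>)) 0 \<partial>M)"
      by (intro Bochner_Integration.integral_cong) auto
    also have "\<dots> = (\<integral>\<omega>. max (m + s * X \<omega>) 0 \<partial>M) - (\<integral>\<omega>. max (- (m + s * X \<omega>)) 0 \<partial>M)"
      using int by (intro Bochner_Integration.integral_diff integrable_max integrable_minus) auto
    finally show ?thesis .
  qed
  \<comment> \<open>\<open>mean\<close> turns both sides into differences of positive and negative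
    parts, which \<open>pos\<close> and \<open>neg\<close> identify.\<close>
  have "\<mu> + \<sigma> * expectation X = \<mu>' + \<sigma>' * expectation X"
    unfolding mean pos neg ..
  with \<open>\<sigma> = \<sigma>'\<close> show ?thesis by simp
qed

end
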